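(* Let $P$ be a countable set of propositional symbols. There is no P-graph transformation $\dagger: \mathbb{G}(P)\times \mathcal{L}_0(P) \rightarrow \mathbb{G}(P)$ that induces Natural Revision. That is, there is no function $\dagger:\mathbb{G}(P)\times \mathcal{L}_0(P) \rightarrow \mathbb{G}(P)$ such that for all preference models $M$, all P-graphs $G\in\mathbb{G}(P)$ and all $\varphi\in\mathcal{L}_0(P)$, if $M$ is induced by $G$ then the natural revision $M_{\uparrow\varphi}$ is induced by $\dagger(G,\varphi)$.
   Context: $\mathcal{L}_0(P)$ is the set of classical propositional formulas over $P$. P-graph: a pair $G=\langle\Phi,\prec\rangle$ with $\Phi\subseteq\mathcal{L}_0(P)$ and $\prec$ a strict partial order on $\Phi$. $\mathbb{G}(P)$ is the set of all P-graphs over $P$. A P-graph transformation is any function $\dagger:\mathbb{G}(P)\times\mathcal{L}_0(P)\to\mathbb{G}(P)$. Given a non-empty set $W$ of worlds and a valuation $v:P\to 2^W$, $w\vDash\varphi$ denotes classical satisfaction of $\varphi$ at $w$ (with $w\vDash p$ iff $w\in v(p)$), and $\llbracket\varphi\rrbracket=\{w\in W: w\vDash\varphi\}$. The relation $\leq_G$ on $W$ is: $w\leq_G w'$ iff for every $\varphi\in\Phi$, either ($w'\vDash\varphi$ implies $w\vDash\varphi$), or there is $\psi\in\Phi$ with $\psi\prec\varphi$, $w\vDash\psi$ and $w'\not\vDash\psi$. Preference model: $M=\langle W,\leq,v\rangle$ with $W$ a non-empty set, $v:P\to 2^W$, and $\leq$ a reflexive transitive relation on $W$ whose strict part $<$ ($w<w'$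 iff $w\leq w'$ and not $w'\leq w$) is well-founded. For $X\subseteq W$, $\mathit{Min}_\leq X=\{w\in X:\text{ there is no } w'\in X \text{ with } w'<w\}$. $M$ is induced by a P-graph $G$ iff $\leq\;=\;\leq_G$ (computed with $W$ and $v$). Natural revision of $M=\langle W,\leq,v\rangle$ by $\varphi\in\mathcal{L}_0(P)$: the preference model $M_{\uparrow\varphi}=\langle W,\leq_{\uparrow\varphi},v\rangle$, where $w\leq_{\uparrow\varphi}w'$ iff $w\in\mathit{Min}_\leq\llbracket\varphi\rrbracket$, or ($w\leq w'$ and $w,w'\notin\mathit{Min}_\leq\llbracket\varphi\rrbracket$).
   Formalization: The set P is additionally assumed to contain at least two distinct propositional symbols; with at most one symbol there are at most two distinguishable kinds of worlds and a P-graph transformation inducing natural revision does exist. *)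

theory Defs
  imports "HOL-Library.Countable_Set" "HOL-Library.FuncSet"
begin

datatype (atoms: 'p) form =
    Atom 'p
  | Falsum
  | Neg "'p form"
  | Conj "'p form" "'p form"
  | Disj "'p form" "'p form"
  | Impl "'p form" "'p form"

definition formulas :: "'p set \<Rightarrow> 'p form set" where
  "formulas P = {\<phi>. atoms \<phi> \<subseteq> P}"

primrec sat :: "('p \<Rightarrow> 'w set) \<Rightarrow> 'w \<Rightarrow> 'p form \<Rightarrow> bool" where
  "sat v w (Atom p) \<longleftrightarrow> w \<in> v p"
| "sat v w Falsum \<longleftrightarrow> False"
| "sat v w (Neg \<phi>) \<longleftrightarrow> \<not> sat v w \<phi>"
| "sat v w (Conj \<phi> \<psi>) \<longleftrightarrow> sat v w \<phi> \<and> sat v w \<psi>"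
| "sat v w (Disj \<phi> \<psi>) \<longleftrightarrow> sat v w \<phi> \<or> sat v w \<psi>"
| "sat v w (Impl \<phi> \<psi>) \<longleftrightarrow> (sat v w \<phi> \<longrightarrow> sat v w \<psi>)"

definition truth_set :: "'w set \<Rightarrow> ('p \<Rightarrow> 'w set) \<Rightarrow> 'p form \<Rightarrow> 'w set" where
  "truth_set W v \<phi> = {w \<in> W. sat v w \<phi>}"

record 'p pgraph =
  nodes :: "'p form set"
  prec :: "'p form rel"

definition pgraphs :: "'p set \<Rightarrow> 'p pgraph set" where
  "pgraphs P = {G. nodes G \<subseteq> formulas P \<and> prec G \<subseteq> nodes G \<times> nodes G \<and>
     irrefl (prec G) \<and> trans (prec G)}"

definition graph_le :: "'w set \<Rightarrow> ('p \<Rightarrow> 'w set) \<Rightarrow> 'p pgraph \<Rightarrow> 'w rel" where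
  "graph_le W v G = {(w, w') \<in> W \<times> W. \<forall>\<phi> \<in> nodes G.
     (sat v w' \<phi> \<longrightarrow> sat v w \<phi>) \<or>
     (\<exists>\<psi> \<in> nodes G. (\<psi>, \<phi>) \<in> prec G \<and> sat v w \<psi> \<and> \<not> sat v w' \<psi>)}"

record ('w, 'p) pref_model =
  worlds :: "'w set"
  le :: "'w rel"
  val :: "'p \<Rightarrow> 'w set"

definition strict :: "'w rel \<Rightarrow> 'w rel" where
  "strict r = {(w, w'). (w, w') \<in> r \<and> (w', w) \<notin> r}"

(* The valuation is a total function on the type of symbols; only its values on P matter
   for formulas over P, so only these are constrained. *)
definition pref_models :: "'p set \<Rightarrow> ('w, 'p) pref_model set" where
  "pref_models P = {M. worlds M \<noteq> {} \<and> (\<forall>p \<in> P. val M p \<subseteq> worlds M) \<and>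
     preorder_on (worlds M) (le M) \<and> wf (strict (le M))}"

definition Minimal :: "'w rel \<Rightarrow> 'w set \<Rightarrow> 'w set" where
  "Minimal r X = {w \<in> X. \<not> (\<exists>w' \<in> X. (w', w) \<in> strict r)}"

definition induced_by :: "('w, 'p) pref_model \<Rightarrow> 'p pgraph \<Rightarrow> bool" where
  "induced_by M G \<longleftrightarrow> le M = graph_le (worlds M) (val M) G"

definition natural_revision :: "('w, 'p) pref_model \<Rightarrow> 'p form \<Rightarrow> ('w, 'p) pref_model" where
  "natural_revision M \<phi> =
     (let m = Minimal (le M) (truth_set (worlds M) (val M) \<phi>) in
      M\<lparr>le := {(w, w') \<in> worlds M \<times> worlds M.
                w \<in> m \<or> (w, w') \<in> le M \<and> w \<notin> m \<and> w' \<notin> m}\<rparr>)"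

lemma natural_revision_pref_model:
  assumes M: "M \<in> pref_models P"
  shows "natural_revision M \<phi> \<in> pref_models P"
proof -
  define m where "m = Minimal (le M) (truth_set (worlds M) (val M) \<phi>)"
  define r where "r = {(w, w') \<in> worlds M \<times> worlds M.
                w \<in> m \<or> (w, w') \<in> le M \<and> w \<notin> m \<and> w' \<notin> m}"
  have N: "natural_revision M \<phi> = M\<lparr>le := r\<rparr>"
    by (simp add: natural_revision_def r_def m_def Let_def)
  have pre: "preorder_on (worlds M) (le M)" and wf: "wf (strict (le M))"
    using M by (auto simp: pref_models_def)
  have "refl_on (worlds M) r"
    using pre by (auto simp: r_def preorder_on_def refl_on_def)
  moreover have "trans r"
    using pre unfolding r_def preorder_on_def trans_def by blast
  moreover have "r \<subseteq> worlds M \<times> worlds M"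
    by (auto simp: r_def)
  moreover have "wf (strict r)"
  proof (rule wf_subset)
    show "wf (inv_image (less_than <*lex*> strict (le M)) (\<lambda>w. (if w \<in> m then 0 else 1, w)))"
      using wf by auto
    show "strict r \<subseteq> inv_image (less_than <*lex*> strict (le M)) (\<lambda>w. (if w \<in> m then 0 else 1, w))"
      by (auto simp: strict_def r_def)
  qed
  ultimately show ?thesis
    using M by (auto simp: N pref_models_def preorder_on_def)
qed

end

(* A P-graph orders a pair of worlds by looking only at their own valuations, whereas natural
   revision by p promotes a p-world b only if no better p-world is present. With the single
   node q, take worlds a (only q), b (only p) and c (both): among {a, b} the world b is the
   minimal p-world and ends up strictly below a, while among {a, b, c} the minimal p-world is c
   and a stays below b. The same revised graph would have to induce both orders. *)
theory Submission
  imports Defs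
begin

lemma sat_restrict_valuation:
  assumes "w \<in> W"
  shows "sat (\<lambda>x. v x \<inter> W) w \<phi> \<longleftrightarrow> sat v w \<phi>"
  using assms by (induction \<phi>) auto

text \<open>\<open>graph_le\<close> evaluates formulas only at the two compared worlds, so the
  presence of further worlds cannot affect the pair.\<close>

lemma graph_le_restrict:
  assumes "w \<in> W" and "w' \<in> W" and "W \<subseteq> U"
  shows "(w, w') \<in> graph_le W (\<lambda>x. v x \<inter> W) G \<longleftrightarrow> (w, w') \<in> graph_le U (\<lambda>x. v x \<inter> U) G"
proof -
  have "w \<in> U" "w' \<in> U"
    using assms by auto
  then show ?thesis
    using assms(1,2) by (simp add: graph_le_def sat_restrict_valuation)
qed

definition atom_graph :: "'p \<Rightarrow> 'p pgraph" where
  "atom_graph q = \<lparr>nodes = {Atom q}, prec = {}\<rparr>"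

text \<open>The order puts \<open>q\<close>-worlds lowest. Models over different \<open>W\<close>
  share one \<open>v\<close>, cut down to \<open>W\<close> because \<open>pref_models\<close> wants
  valuations inside the worlds.\<close>

definition atom_model :: "'p \<Rightarrow> ('p \<Rightarrow> 'w set) \<Rightarrow> 'w set \<Rightarrow> ('w, 'p) pref_model" where
  "atom_model q v W =
     \<lparr>worlds = W, le = {(w, w') \<in> W \<times> W. w' \<in> v q \<longrightarrow> w \<in> v q}, val = (\<lambda>x. v x \<inter> W)\<rparr>"

lemma atom_graph_in_pgraphs: "q \<in> P \<Longrightarrow> atom_graph q \<in> pgraphs P"
  by (simp add: atom_graph_def pgraphs_def formulas_def irrefl_def)

lemma atom_model_in_pref_models:
  assumes "W \<noteq> {}"
  shows "atom_model q v W \<in> pref_models P"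
proof -
  let ?r = "{(w, w') \<in> W \<times> W. w' \<in> v q \<longrightarrow> w \<in> v q}"
  have "preorder_on W ?r"
    by (auto simp: preorder_on_def refl_on_def trans_def)
  moreover have "wf (strict ?r)"
  proof (rule wf_subset)
    show "wf (measure (\<lambda>w. if w \<in> v q then 0 else 1))"
      by simp
    show "strict ?r \<subseteq> measure (\<lambda>w. if w \<in> v q then 0 else 1)"
      by (auto simp: strict_def)
  qed
  ultimately show ?thesis
    using assms by (simp add: atom_model_def pref_models_def)
qed

lemma atom_model_induced: "induced_by (atom_model q v W) (atom_graph q)"
  by (auto simp: induced_by_def atom_model_def atom_graph_def graph_le_def)

lemma infinite_three_distinct:
  assumes "infinite (UNIV :: 'a set)"
  obtains a b c :: 'a where "a \<noteq> b" and "a \<noteq> c" and "b \<noteq> c"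
proof -
  obtain T :: "'a set" where "card T = 3"
    using infinite_arbitrarily_large[OF assms] by blast
  then show ?thesis
    using that by (auto simp: card_3_iff)
qed

(* No transformation works even for the models whose worlds are drawn from one given infinite
   type 'w; hence none works for the models over arbitrary sets of worlds. With at most one
   symbol there are at most two propositionally distinct worlds and the claim fails. *)
theorem corollary23:
  fixes P :: "'p set"
  assumes "countable P" and "\<exists>p \<in> P. \<exists>q \<in> P. p \<noteq> q"
    and "infinite (UNIV :: 'w set)"
  shows "\<not> (\<exists>dagger :: 'p pgraph \<times> 'p form \<Rightarrow> 'p pgraph.
    dagger \<in> pgraphs P \<times> formulas P \<rightarrow> pgraphs P \<and>
    (\<forall>M \<in> (pref_models P :: ('w, 'p) pref_model set). \<forall>G \<in> pgraphs P. \<forall>\<phi> \<in> formulas P.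
      induced_by M G \<longrightarrow> induced_by (natural_revision M \<phi>) (dagger (G, \<phi>))))"
proof
  assume "\<exists>dagger :: 'p pgraph \<times> 'p form \<Rightarrow> 'p pgraph.
    dagger \<in> pgraphs P \<times> formulas P \<rightarrow> pgraphs P \<and>
    (\<forall>M \<in> (pref_models P :: ('w, 'p) pref_model set). \<forall>G \<in> pgraphs P. \<forall>\<phi> \<in> formulas P.
      induced_by M G \<longrightarrow> induced_by (natural_revision M \<phi>) (dagger (G, \<phi>)))"
  then obtain dagger :: "'p pgraph \<times> 'p form \<Rightarrow> 'p pgraph" where
    dagger: "\<And>(M :: ('w, 'p) pref_model) G \<phi>.
      \<lbrakk>M \<in> pref_models P; G \<in> pgraphs P; \<phi> \<in> formulas P; induced_by M G\<rbrakk>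
      \<Longrightarrow> induced_by (natural_revision M \<phi>) (dagger (G, \<phi>))"
    by blast
  obtain p q where pq: "p \<in> P" "q \<in> P" "p \<noteq> q"
    using assms(2) by blast
  obtain a b c :: 'w where abc: "a \<noteq> b" "a \<noteq> c" "b \<noteq> c"
    using infinite_three_distinct[OF assms(3)] .
  define v where "v = (\<lambda>x. if x = p then {b, c} else if x = q then {a, c} else {})"
  \<comment> \<open>\<open>H\<close> is fixed before any set of worlds is chosen, so it must serve
    both models.\<close>
  define H where "H = dagger (atom_graph q, Atom p)"
  have revised: "le (natural_revision (atom_model q v W) (Atom p)) = graph_le W (\<lambda>x. v x \<inter> W) H"
    if "W \<noteq> {}" for W
  proof -
    have "induced_by (natural_revision (atom_model q v W) (Atom p)) H"
      unfolding H_def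
      using pq that
      by (intro dagger atom_model_in_pref_models atom_graph_in_pgraphs atom_model_induced)
         (auto simp: formulas_def)
    then show ?thesis
      by (simp add: induced_by_def natural_revision_def atom_model_def Let_def)
  qed
  \<comment> \<open>Here \<open>b\<close> is the only \<open>p\<close>-world, hence minimal, and
    \<open>a\<close> is not a \<open>p\<close>-world.\<close>
  have "(a, b) \<notin> le (natural_revision (atom_model q v {a, b}) (Atom p))"
    using abc pq
    by (auto simp: natural_revision_def atom_model_def Minimal_def truth_set_def strict_def v_def)
  then have "(a, b) \<notin> graph_le {a, b} (\<lambda>x. v x \<inter> {a, b}) H"
    by (simp add: revised)
  \<comment> \<open>Now \<open>c\<close> lies strictly below \<open>b\<close>, so neither
    \<open>a\<close> nor \<open>b\<close> is a minimal \<open>p\<close>-world and their old order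
    survives.\<close>
  moreover have "(a, b) \<in> le (natural_revision (atom_model q v {a, b, c}) (Atom p))"
    using abc pq
    by (auto simp: natural_revision_def atom_model_def Minimal_def truth_set_def strict_def v_def)
  then have "(a, b) \<in> graph_le {a, b, c} (\<lambda>x. v x \<inter> {a, b, c}) H"
    by (simp add: revised)
  ultimately show False
    using graph_le_restrict[of a "{a, b}" b "{a, b, c}" v H] by simp
qed

end
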